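(* Let $k \ge 1$ and $n=k+1$, let $m$ be a nonnegative integer, and let $x=(x_1,\dots,x_n)$ be a position of the game $\mathrm{NIM}(n,k)$. Then $x$ is $m$-critical if and only if one of the following two cases holds: (A) $x_1+\dots+x_n = km$; $\max(x_1,\dots,x_n)\le m$; if $m$ is even then all $n$ coordinates of $x$ are even; if $m$ is odd then exactly one of the $n$ coordinates of $x$ is even. (B) $x_1+\dots+x_n = km+k-1$; $\max(x_1,\dots,x_n) < m$; $m$ is even; and all $n$ coordinates of $x$ are odd.
   Context: The game $\mathrm{NIM}(n,k)$ ($0<k\le n$): a position is an $n$-tuple $x=(x_1,\dots,x_n)$ of nonnegative integers (pile sizes). By one move a player chooses $k$ piles, all of them nonempty, and removes exactly one stone from each of them. Two players alternate turns; a player who has to move but cannot loses. A position is terminal if no move is possible from it. Here $n=k+1$, so a move keeps exactly one pile and reduces all the others by $1$. M-rule (for $n=k+1$): from a nonterminal position, if all piles are odd, keep a largest pile and reduce all others by one; if there are even piles, keep a smallest even pile and reduce all others by one (0 counts as even). This defines a unique move up to renumbering of the piles. $\mathcal{M}(x)$ denotes the number of moves made from $x$ until a terminal position is reached when both players always follow the M-rule. For $n$-vectors $x,y$, let $x^*,y^*$ be obtained by sorting the coordinates in nondecreasing order. Write $x\succeq y$ if $x^*_i\ge y^*_i$ for all $i\in\{1,\dots,n\}$, and $x\succ y$ if in addition $x^*\ne y^*$. A position $x$ is called $m$-critical if $\mathcal{M}(x)=m$ and there is no position $y$ with $\mathcal{M}(y)=m$ and $x\succ y$. *)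

theory Defs
  imports "HOL-Library.Multiset"
begin

definition positions :: "nat \<Rightarrow> nat list set" where
  "positions n = {x. length x = n}"

definition remove_stones :: "nat set \<Rightarrow> nat list \<Rightarrow> nat list" where
  "remove_stones K x = map (\<lambda>j. if j \<in> K then x ! j - 1 else x ! j) [0..<length x]"

text \<open>The number of piles is the length of the list.\<close>

definition nim_move :: "nat \<Rightarrow> nat list \<Rightarrow> nat list \<Rightarrow> bool" where
  "nim_move k x y \<longleftrightarrow>
     (\<exists>K \<subseteq> {..<length x}. card K = k \<and> (\<forall>j\<in>K. 0 < x ! j) \<and> y = remove_stones K x)"

definition nim_terminal :: "nat \<Rightarrow> nat list \<Rightarrow> bool" where
  "nim_terminal k x \<longleftrightarrow> \<not> (\<exists>y. nim_move k x y)"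

definition M_kept :: "nat list \<Rightarrow> nat \<Rightarrow> bool" where
  "M_kept x i \<longleftrightarrow> i < length x \<and>
     (if \<forall>j<length x. odd (x ! j)
      then \<forall>j<length x. x ! j \<le> x ! i
      else even (x ! i) \<and> (\<forall>j<length x. even (x ! j) \<longrightarrow> x ! i \<le> x ! j))"

text \<open>Ties between equal piles are left open, so \<open>M_move\<close> is a relation, meant for
  positions with \<open>k + 1\<close> piles. There it yields legal moves (\<open>M_move_legal\<close>), and
  the number of moves to a terminal position does not depend on how the ties are
  resolved (\<open>M_length_unique\<close>).\<close>

definition M_move :: "nat \<Rightarrow> nat list \<Rightarrow> nat list \<Rightarrow> bool" where
  "M_move k x y \<longleftrightarrow> \<not> nim_terminal k x \<and>
     (\<exists>i. M_kept x i \<and> y = remove_stones ({..<length x} - {i}) x)"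

definition M_length :: "nat \<Rightarrow> nat list \<Rightarrow> nat" where
  "M_length k x = (THE m. \<exists>y. (M_move k ^^ m) x y \<and> nim_terminal k y)"

text \<open>The relation \<open>list_all2\<close> also forces both lists to have the same length.\<close>

definition dominates :: "nat list \<Rightarrow> nat list \<Rightarrow> bool" where
  "dominates x y \<longleftrightarrow> list_all2 (\<ge>) (sort x) (sort y)"

definition strictly_dominates :: "nat list \<Rightarrow> nat list \<Rightarrow> bool" where
  "strictly_dominates x y \<longleftrightarrow> dominates x y \<and> sort x \<noteq> sort y"

definition critical :: "nat \<Rightarrow> nat \<Rightarrow> nat list \<Rightarrow> bool" where
  "critical k m x \<longleftrightarrow> x \<in> positions (k + 1) \<and> M_length k x = m \<and>
     \<not> (\<exists>y \<in> positions (k + 1). M_length k y = m \<and> strictly_dominates x y)"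


lemma length_remove_stones [simp]: "length (remove_stones K x) = length x"
  by (simp add: remove_stones_def)

lemma nim_terminal_iff:
  "nim_terminal k x \<longleftrightarrow> card {j. j < length x \<and> 0 < x ! j} < k"
proof -
  let ?P = "{j. j < length x \<and> 0 < x ! j}"
  have fin: "finite ?P" by simp
  have "(\<exists>y. nim_move k x y) \<longleftrightarrow> (\<exists>K \<subseteq> ?P. card K = k)"
    unfolding nim_move_def by blast
  also have "\<dots> \<longleftrightarrow> k \<le> card ?P"
  proof
    assume "\<exists>K \<subseteq> ?P. card K = k"
    then show "k \<le> card ?P" using fin card_mono by blast
  next
    assume "k \<le> card ?P"
    then obtain K where "K \<subseteq> ?P" "card K = k" by (rule obtain_subset_with_card_n)
    then show "\<exists>K \<subseteq> ?P. card K = k" by blast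
  qed
  finally show ?thesis
    by (simp add: nim_terminal_def not_le)
qed

lemma nim_terminal_mset:
  assumes "mset x = mset x'"
  shows "nim_terminal k x \<longleftrightarrow> nim_terminal k x'"
proof -
  have "card {j. j < length z \<and> 0 < z ! j} = size (filter_mset (\<lambda>v. 0 < v) (mset z))"
    for z :: "nat list"
    unfolding mset_filter[symmetric] size_mset length_filter_conv_card ..
  then show ?thesis using assms by (simp add: nim_terminal_iff)
qed

lemma M_kept_exists:
  assumes "x \<noteq> []"
  shows "\<exists>i. M_kept x i"
proof (cases "\<forall>j<length x. odd (x ! j)")
  case True
  have "Max (set x) \<in> set x" using assms by simp
  then obtain i where "i < length x" "x ! i = Max (set x)"
    by (metis in_set_conv_nth)
  then show ?thesis using True unfolding M_kept_def by (auto intro!: exI[of _ i])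
next
  case False
  let ?E = "{v \<in> set x. even v}"
  have fin: "finite ?E" by simp
  have "?E \<noteq> {}" using False nth_mem by fastforce
  then have "Min ?E \<in> ?E" using fin Min_in by blast
  then obtain i where i: "i < length x" "x ! i = Min ?E" "even (x ! i)"
    by (auto simp: in_set_conv_nth)
  have "\<forall>j<length x. even (x ! j) \<longrightarrow> x ! i \<le> x ! j"
    using i(2) fin by (auto intro!: Min_le)
  then show ?thesis using False i unfolding M_kept_def by auto
qed

lemma M_kept_value_unique:
  assumes "mset x = mset x'" "M_kept x i" "M_kept x' i'"
  shows "x ! i = x' ! i'"
proof -
  have s: "set x = set x'" using assms(1) by (metis set_mset_mset)
  have "x ! i \<in> set x" "x' ! i' \<in> set x'"
    using assms(2,3) unfolding M_kept_def by (meson nth_mem)+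
  then have i: "x ! i \<in> set x" "x' ! i' \<in> set x"
    unfolding s by simp_all
  have c: "if \<forall>v\<in>set x. odd v then \<forall>v\<in>set x. v \<le> x ! i
        else even (x ! i) \<and> (\<forall>v\<in>set x. even v \<longrightarrow> x ! i \<le> v)"
    using assms(2) unfolding M_kept_def all_set_conv_all_nth by (rule conjunct2)
  have "if \<forall>v\<in>set x'. odd v then \<forall>v\<in>set x'. v \<le> x' ! i'
        else even (x' ! i') \<and> (\<forall>v\<in>set x'. even v \<longrightarrow> x' ! i' \<le> v)"
    using assms(3) unfolding M_kept_def all_set_conv_all_nth by (rule conjunct2)
  then have c': "if \<forall>v\<in>set x. odd v then \<forall>v\<in>set x. v \<le> x' ! i'
        else even (x' ! i') \<and> (\<forall>v\<in>set x. even v \<longrightarrow> x' ! i' \<le> v)"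
    unfolding s .
  show ?thesis
  proof (cases "\<forall>v\<in>set x. odd v")
    case True
    then have "\<forall>v\<in>set x. v \<le> x ! i" "\<forall>v\<in>set x. v \<le> x' ! i'"
      using c c' by (metis (full_types))+
    then show ?thesis using i le_antisym by blast
  next
    case False
    then have "even (x ! i) \<and> (\<forall>v\<in>set x. even v \<longrightarrow> x ! i \<le> v)"
      "even (x' ! i') \<and> (\<forall>v\<in>set x. even v \<longrightarrow> x' ! i' \<le> v)"
      using c c' by (metis (full_types))+
    then show ?thesis using i le_antisym by blast
  qed
qed

lemma mset_remove_all_but_one:
  assumes "i < length x"
  shows "mset (remove_stones ({..<length x} - {i}) x) =
    add_mset (x ! i) (image_mset (\<lambda>v. v - 1) (mset x) - {#x ! i - 1#})"
proof -
  have "remove_stones ({..<length x} - {i}) x = (map (\<lambda>v. v - 1) x)[i := x ! i]"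
    using assms by (intro nth_equalityI) (auto simp: remove_stones_def nth_list_update)
  then show ?thesis using assms by (simp add: mset_update)
qed

lemma M_move_mset:
  assumes "mset x = mset x'" "M_move k x y" "M_move k x' y'"
  shows "mset y = mset y'"
proof -
  from assms(2) obtain i where i: "M_kept x i" "y = remove_stones ({..<length x} - {i}) x"
    by (auto simp: M_move_def)
  from assms(3) obtain i' where i': "M_kept x' i'" "y' = remove_stones ({..<length x'} - {i'}) x'"
    by (auto simp: M_move_def)
  have "x ! i = x' ! i'" using M_kept_value_unique[OF assms(1) i(1) i'(1)] .
  then show ?thesis
    using i i' assms(1) by (simp add: mset_remove_all_but_one M_kept_def)
qed

lemma M_move_legal:
  assumes "x \<in> positions (k + 1)" "M_move k x y"
  shows "nim_move k x y"
proof -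
  have len: "length x = k + 1" using assms(1) by (simp add: positions_def)
  from assms(2) obtain i where nt: "\<not> nim_terminal k x" and i: "M_kept x i"
    and y: "y = remove_stones ({..<length x} - {i}) x" by (auto simp: M_move_def)
  have il: "i < length x" using i by (simp add: M_kept_def)
  have "0 < x ! j" if j: "j < length x" "j \<noteq> i" for j
  proof (rule ccontr)
    assume "\<not> 0 < x ! j"
    then have z: "x ! j = 0" by simp
    then have "x ! i = 0" using i j by (fastforce simp: M_kept_def split: if_splits)
    then have sub: "{j. j < length x \<and> 0 < x ! j} \<subseteq> {..<length x} - {i, j}" using z by auto
    have "card ({..<length x} - {i, j}) = length x - 2"
      using il j by (subst card_Diff_subset) auto
    with sub have le: "card {j. j < length x \<and> 0 < x ! j} \<le> length x - 2"
      by (metis card_mono finite_Diff finite_lessThan)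
    moreover have "length x \<ge> 2" using il j by linarith
    ultimately show False using nt len by (simp add: nim_terminal_iff)
  qed
  moreover have "card ({..<length x} - {i}) = k" using il len by simp
  ultimately show ?thesis unfolding nim_move_def y
    by (intro exI[of _ "{..<length x} - {i}"]) auto
qed

lemma nim_move_sum_list:
  assumes "nim_move k x y" "0 < k"
  shows "sum_list y < sum_list x"
proof -
  from assms(1) obtain K where K: "K \<subseteq> {..<length x}" "card K = k" "\<forall>j\<in>K. 0 < x ! j"
    and y: "y = remove_stones K x" by (auto simp: nim_move_def)
  obtain j where j: "j \<in> K" using K(2) assms(2) by fastforce
  have "j < length x" using K(1) j by auto
  then have "(\<Sum>i\<in>{0..<length x}. y ! i) < (\<Sum>i\<in>{0..<length x}. x ! i)"
    using K j by (intro sum_strict_mono_ex1) (auto simp: y remove_stones_def intro!: bexI[of _ j])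
  then show ?thesis by (simp add: sum_list_sum_nth y)
qed

lemma M_run_exists:
  assumes "x \<in> positions (k + 1)" "0 < k"
  shows "\<exists>m y. (M_move k ^^ m) x y \<and> nim_terminal k y"
  using assms(1)
proof (induction "sum_list x" arbitrary: x rule: less_induct)
  case less
  show ?case
  proof (cases "nim_terminal k x")
    case True
    then show ?thesis by (intro exI[of _ 0]) auto
  next
    case False
    have "x \<noteq> []" using less.prems by (auto simp: positions_def)
    then obtain z where z: "M_move k x z"
      using False M_kept_exists unfolding M_move_def by blast
    have zp: "z \<in> positions (k + 1)"
      using z less.prems by (auto simp: M_move_def positions_def)
    have "sum_list z < sum_list x"
      using nim_move_sum_list[OF M_move_legal[OF less.prems z] assms(2)] .
    then obtain m y where "(M_move k ^^ m) z y" "nim_terminal k y"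
      using less.hyps zp by blast
    then show ?thesis using relpowp_Suc_I2[of "M_move k", OF z] by blast
  qed
qed

lemma M_run_unique:
  assumes "mset x = mset x'"
    and "(M_move k ^^ m) x y" "nim_terminal k y"
    and "(M_move k ^^ m') x' y'" "nim_terminal k y'"
  shows "m = m'"
  using assms
proof (induction m arbitrary: m' x x')
  case 0
  then have "x = y" by simp
  then have t: "nim_terminal k x'" using nim_terminal_mset[OF "0.prems"(1)] "0.prems"(3) by blast
  show ?case
  proof (cases m')
    case (Suc l)
    then obtain z where "M_move k x' z"
      using "0.prems"(4) by (meson relpowp_Suc_D2)
    then show ?thesis using t by (simp add: M_move_def)
  qed simp
next
  case (Suc m)
  obtain z where z: "M_move k x z" "(M_move k ^^ m) z y"
    using Suc.prems(2) by (meson relpowp_Suc_D2)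
  have nt: "\<not> nim_terminal k x'"
    using z(1) nim_terminal_mset[OF Suc.prems(1)] by (simp add: M_move_def)
  then obtain l where l: "m' = Suc l" using Suc.prems(4,5) by (cases m') simp_all
  obtain z' where z': "M_move k x' z'" "(M_move k ^^ l) z' y'"
    using Suc.prems(4) unfolding l by (meson relpowp_Suc_D2)
  have "m = l"
    using Suc.IH[OF M_move_mset[OF Suc.prems(1) z(1) z'(1)] z(2) Suc.prems(3) z'(2) Suc.prems(5)] .
  then show ?case using l by simp
qed

lemma M_length_unique:
  assumes "x \<in> positions (k + 1)" "0 < k"
  shows "\<exists>!m. \<exists>y. (M_move k ^^ m) x y \<and> nim_terminal k y"
proof (rule ex_ex1I)
  show "\<exists>m y. (M_move k ^^ m) x y \<and> nim_terminal k y" using M_run_exists[OF assms] .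
next
  fix m m'
  assume "\<exists>y. (M_move k ^^ m) x y \<and> nim_terminal k y"
    "\<exists>y. (M_move k ^^ m') x y \<and> nim_terminal k y"
  then show "m = m'" by (elim exE conjE) (rule M_run_unique[OF refl])
qed

end

theory Submission
  imports Defs
begin

text \<open>
  Call the positions of case (A) exact and those of case (B) surplus; an extremal position
  is one of either kind. Every move removes \<open>k\<close> stones, so a position with
  fewer than \<open>k * (m + 1)\<close> stones lasts at most \<open>m\<close> moves. An exact position
  has just enough stones for \<open>m\<close> moves and a surplus position has \<open>k - 1\<close> left
  over. The characterisation rests on three facts.

  \<^item> An extremal position does last \<open>m\<close> moves (\<open>M_length_extremal\<close>). The
    M-rule takes an exact position for \<open>m + 1\<close> to an exact position for \<open>m\<close>. From a
    surplus position it leads into a family with the same stone count but other parities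
    (\<open>surplus_successor\<close>), which the rule then preserves. The bounds on the largest
    pile prevent two piles from being empty too early.

  \<^item> Every position of length \<open>m\<close> lies above an extremal position for \<open>m\<close>
    (\<open>extremal_below\<close>), by induction along the play: given an extremal \<open>y\<close> below the
    position after the move, add one stone to each pile of \<open>y\<close> except the one the move kept.
    The result lies below the position before the move, but may have wrong parities. Moving
    one or two stones between its piles (\<open>rebalance_two_odd\<close>) repairs it unless every
    pile is tight. In that event the position before the move is itself a surplus position; this
    is where case (B) comes from. If \<open>y\<close> is a surplus position, raising one pile of \<open>y\<close>
    already gives an exact position.

  \<^item> Extremal positions for the same \<open>m\<close> are pairwise incomparable
    (\<open>extremal_antichain\<close>). Two of the same kind have the same sum. A surplus position
    has odd piles only and an exact one, for even \<open>m\<close>, even piles only, so domination would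
    cost at least \<open>k + 1\<close> stones, whereas the sums differ by \<open>k - 1\<close>.

  A critical position lies above an extremal one of the same length, hence equals it up to
  order. Conversely, whatever lies strictly below an extremal position and has the same
  length would itself lie above an extremal position, against incomparability.
\<close>

section \<open>Domination and sorting\<close>

lemma list_all2_ge_insort:
  fixes xs ys :: "'a::linorder list"
  assumes "list_all2 (\<ge>) xs ys" "sorted xs" "sorted ys" "a \<ge> b"
  shows "list_all2 (\<ge>) (insort a xs) (insort b ys)"
  using assms
proof (induction xs ys arbitrary: a b rule: list_all2_induct)
  case Nil
  then show ?case by simp
next
  case (Cons x xs y ys)
  have ins: "insort x xs = x # xs" "insort y ys = y # ys"
    using Cons.prems(1,2) by (simp_all add: insort_is_Cons)
  have s: "sorted xs" "sorted ys" using Cons.prems(1,2) by simp_all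
  have 1: "list_all2 (\<ge>) (x # xs) (insort b ys)" if "a \<le> x"
    using Cons.IH[OF s, of b x] Cons.prems(3) that ins(1) by simp
  have 2: "list_all2 (\<ge>) (insort a xs) (y # ys)" if "a > x"
    using Cons.IH[OF s, of y a] Cons.hyps that ins(2) by simp
  show ?case
    using 1 2 Cons.IH[OF s Cons.prems(3)] Cons.hyps Cons.prems(3) by auto
qed

text \<open>Domination compares sorted tuples, whereas the constructions below yield inequalities pile
  by pile. Insertion sort turns the latter into the former, one insertion at a time.\<close>

lemma list_all2_ge_sort:
  fixes xs ys :: "'a::linorder list"
  assumes "list_all2 (\<ge>) xs ys"
  shows "list_all2 (\<ge>) (sort xs) (sort ys)"
  using assms by (induction rule: list_all2_induct) (simp_all add: list_all2_ge_insort)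

lemma dominatesI:
  assumes "length x = length y" "\<And>j. j < length x \<Longrightarrow> y ! j \<le> x ! j"
  shows "dominates x y"
  unfolding dominates_def using assms by (intro list_all2_ge_sort) (simp add: list_all2_conv_all_nth)

lemma dominates_trans:
  assumes "dominates x y" "dominates y z"
  shows "dominates x z"
  using assms unfolding dominates_def by (auto elim: list_all2_trans[rotated])

lemma sum_list_sort: "sum_list (sort x) = sum_list (x :: nat list)"
  by (metis mset_sort sum_mset_sum_list)

lemma list_all2_ge_sum_list:
  fixes xs ys :: "nat list"
  assumes "list_all2 (\<ge>) xs ys"
  shows "sum_list ys \<le> sum_list xs"
  using assms by (induction rule: list_all2_induct) simp_all

lemma dominates_sum_list: "dominates x y \<Longrightarrow> sum_list y \<le> sum_list x"
  using list_all2_ge_sum_list[of "sort x" "sort y"] by (simp add: dominates_def sum_list_sort)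

lemma list_all2_ge_eq_sum_list:
  fixes xs ys :: "nat list"
  assumes "list_all2 (\<ge>) xs ys" "sum_list xs = sum_list ys"
  shows "xs = ys"
  using assms
proof (induction rule: list_all2_induct)
  case (Cons x xs y ys)
  then show ?case using list_all2_ge_sum_list[OF Cons.hyps(2)] by simp
qed simp

lemma strictly_dominates_sum_list:
  "strictly_dominates x y \<Longrightarrow> sum_list y < sum_list x"
  using list_all2_ge_eq_sum_list[of "sort x" "sort y"] list_all2_ge_sum_list[of "sort x" "sort y"]
  by (auto simp: strictly_dominates_def dominates_def sum_list_sort order_le_less)

text \<open>Comparable entries of opposite parity differ by at least one.\<close>

lemma list_all2_ge_odd_even_sum_list:
  fixes xs ys :: "nat list"
  assumes "list_all2 (\<ge>) xs ys" "\<forall>v\<in>set xs. odd v" "\<forall>v\<in>set ys. even v"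
  shows "sum_list ys + length xs \<le> sum_list xs"
  using assms
proof (induction rule: list_all2_induct)
  case (Cons x xs y ys)
  then have "x \<noteq> y" by auto
  then show ?case using Cons by simp
qed simp

lemma dominates_odd_even_sum_list:
  assumes "dominates x y" "\<forall>v\<in>set x. odd v" "\<forall>v\<in>set y. even v"
  shows "sum_list y + length x \<le> sum_list x"
  using list_all2_ge_odd_even_sum_list[of "sort x" "sort y"] assms
  unfolding dominates_def by (simp add: sum_list_sort)


section \<open>Moves of the M-rule\<close>

text \<open>Undoing a move that kept pile \<open>i\<close>. Playing backwards avoids the truncated
  subtraction in \<^const>\<open>remove_stones\<close>.\<close>

definition raise_all_but :: "nat \<Rightarrow> nat list \<Rightarrow> nat list" where
  "raise_all_but i y = (map Suc y)[i := y ! i]"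

lemma length_raise_all_but [simp]: "length (raise_all_but i y) = length y"
  by (simp add: raise_all_but_def)

lemma nth_raise_all_but:
  "j < length y \<Longrightarrow> raise_all_but i y ! j = (if j = i then y ! j else Suc (y ! j))"
  by (auto simp: raise_all_but_def nth_list_update)

lemma sum_list_raise_all_but:
  assumes "length y = k + 1" "i < k + 1"
  shows "sum_list (raise_all_but i y) = sum_list y + k"
proof -
  have "sum_list (map Suc y) = sum_list y + length y" by (induction y) simp_all
  moreover have "sum_list (map Suc y) \<ge> Suc (y ! i)"
    using elem_le_sum_list[of i "map Suc y"] assms by simp
  ultimately show ?thesis using assms by (simp add: raise_all_but_def sum_list_update)
qed

lemma nth_remove_stones:
  "j < length x \<Longrightarrow> remove_stones K x ! j = (if j \<in> K then x ! j - 1 else x ! j)"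
  by (simp add: remove_stones_def)

text \<open>A move of the M-rule is legal, so every pile it lowers is nonempty and the move can be
  reversed without losing stones.\<close>

lemma M_move_obtain:
  assumes "M_move k x y" "length x = k + 1"
  obtains i where "i < k + 1" "M_kept x i" "length y = k + 1" "x = raise_all_but i y"
proof -
  obtain i where i: "M_kept x i" and y: "y = remove_stones ({..<length x} - {i}) x"
    using assms(1) by (auto simp: M_move_def)
  have il: "i < k + 1" using i assms(2) by (simp add: M_kept_def)
  obtain K where K: "K \<subseteq> {..<length x}" "card K = k" "\<forall>j\<in>K. 0 < x ! j" "y = remove_stones K x"
    using M_move_legal[OF _ assms(1)] assms(2) by (auto simp: positions_def nim_move_def)
  \<comment> \<open>A pile of \<open>K\<close> strictly shrinks but pile \<open>i\<close> does not, so the two descriptions of the move agree.\<close>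
  have "i \<notin> K"
  proof
    assume "i \<in> K"
    then have "x ! i - 1 = y ! i" "0 < x ! i" using K(3,4) il assms(2) by (simp_all add: nth_remove_stones)
    moreover have "y ! i = x ! i" using y il assms(2) by (simp add: nth_remove_stones)
    ultimately show False by simp
  qed
  then have "K \<subseteq> {..<length x} - {i}" using K(1) by blast
  moreover have "card ({..<length x} - {i}) = k" using il assms(2) by simp
  ultimately have "K = {..<length x} - {i}" using K(2) by (intro card_subset_eq) auto
  then have "x = raise_all_but i y"
    using K(3) by (intro nth_equalityI) (auto simp: y nth_raise_all_but nth_remove_stones)
  moreover have "length y = k + 1" using y assms(2) by simp
  ultimately show ?thesis using that il i by blast
qed

lemma M_move_exists:
  assumes "length x = k + 1" "\<not> nim_terminal k x"
  shows "\<exists>y. M_move k x y"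
proof -
  have "x \<noteq> []" using assms(1) by auto
  then show ?thesis using assms(2) M_kept_exists unfolding M_move_def by blast
qed

lemma M_length_eqI:
  assumes "length x = k + 1" "0 < k" "(M_move k ^^ m) x y" "nim_terminal k y"
  shows "M_length k x = m"
  unfolding M_length_def
proof (rule the1_equality)
  show "\<exists>!m. \<exists>y. (M_move k ^^ m) x y \<and> nim_terminal k y"
    using M_length_unique[OF _ assms(2)] assms(1) unfolding positions_def by blast
  show "\<exists>y. (M_move k ^^ m) x y \<and> nim_terminal k y" using assms(3,4) by blast
qed

lemma M_length_terminal:
  assumes "length x = k + 1" "0 < k" "nim_terminal k x"
  shows "M_length k x = 0"
proof -
  have "(M_move k ^^ 0) x x" by simp
  then show ?thesis using assms by (intro M_length_eqI)
qed

lemma M_length_step: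
  assumes "length x = k + 1" "0 < k" "M_move k x y"
  shows "M_length k x = Suc (M_length k y)"
proof -
  have ly: "length y = k + 1" using M_move_obtain[OF assms(3,1)] by blast
  obtain l z where z: "(M_move k ^^ l) y z" "nim_terminal k z"
    using M_run_exists[OF _ assms(2)] ly unfolding positions_def by blast
  show ?thesis
    using M_length_eqI[OF ly assms(2) z] M_length_eqI[OF assms(1,2) relpowp_Suc_I2[OF assms(3) z(1)] z(2)]
    by simp
qed

text \<open>In a terminal position at most \<open>k - 1\<close> piles are nonempty, which cannot hold
  many stones if the piles are small.\<close>

lemma not_terminal_if_sum_list_gt:
  assumes "(k - 1) * b < sum_list x" "\<forall>j<length x. x ! j \<le> b"
  shows "\<not> nim_terminal k x"
proof
  assume t: "nim_terminal k x"
  let ?P = "{j. j < length x \<and> 0 < x ! j}"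
  have "sum_list x = (\<Sum>j\<in>{0..<length x}. x ! j)" by (rule sum_list_sum_nth)
  also have "\<dots> = (\<Sum>j\<in>?P. x ! j)" by (rule sum.mono_neutral_right) auto
  also have "\<dots> \<le> card ?P * b" using sum_bounded_above[of ?P "\<lambda>j. x ! j" b] assms(2) by simp
  also have "\<dots> \<le> (k - 1) * b"
    using t by (intro mult_le_mono1) (simp add: nim_terminal_iff)
  finally show False using assms(1) by simp
qed

lemma terminal_if_sum_list_lt:
  assumes "sum_list x < k"
  shows "nim_terminal k x"
proof -
  let ?P = "{j. j < length x \<and> 0 < x ! j}"
  have "card ?P \<le> (\<Sum>j\<in>?P. x ! j)" using sum_mono[of ?P "\<lambda>_. 1" "\<lambda>j. x ! j"] by simp
  also have "\<dots> \<le> (\<Sum>j\<in>{0..<length x}. x ! j)" by (rule sum_mono2) auto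
  finally show ?thesis using assms by (simp add: nim_terminal_iff sum_list_sum_nth)
qed


section \<open>Length of the play from exact and surplus positions\<close>

definition exact_position :: "nat \<Rightarrow> nat \<Rightarrow> nat list \<Rightarrow> bool" where
  "exact_position k m x \<longleftrightarrow> sum_list x = k * m \<and> (\<forall>j<length x. x ! j \<le> m) \<and>
     (if even m then \<forall>j<length x. even (x ! j) else \<exists>!j. j < length x \<and> even (x ! j))"

definition surplus_position :: "nat \<Rightarrow> nat \<Rightarrow> nat list \<Rightarrow> bool" where
  "surplus_position k m x \<longleftrightarrow> sum_list x = k * m + k - 1 \<and> (\<forall>j<length x. x ! j < m) \<and>
     even m \<and> (\<forall>j<length x. odd (x ! j))"

text \<open>The positions reached from a surplus position. Their parities alternate: all piles even but
  one (\<open>m\<close> odd), all piles odd but two (\<open>m\<close> even). While \<open>m > 0\<close>,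
  \<open>k - 1\<close> piles of at most \<open>m + 1\<close> stones cannot hold them all, so the play cannot stop
  before \<open>m = 0\<close>. The bound \<open>m\<close> of exact positions would not be preserved: for
  \<open>k = 2\<close>, the move from \<open>[2, 2, 1]\<close>, with \<open>m = 2\<close>, leads to \<open>[2, 1, 0]\<close>.\<close>

definition surplus_successor :: "nat \<Rightarrow> nat \<Rightarrow> nat list \<Rightarrow> bool" where
  "surplus_successor k m x \<longleftrightarrow> sum_list x = k * m + k - 1 \<and> (\<forall>j<length x. x ! j \<le> m + 1) \<and>
     (if odd m then \<exists>a<length x. \<forall>j<length x. odd (x ! j) \<longleftrightarrow> j = a
      else \<exists>a<length x. \<exists>b<length x. a \<noteq> b \<and> (\<forall>j<length x. even (x ! j) \<longleftrightarrow> j = a \<or> j = b))"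

text \<open>For odd \<open>Suc m\<close> the unique even pile is kept and becomes one of all even piles; for
  even \<open>Suc m\<close> the kept pile becomes the unique even one. Only a kept pile of size
  \<open>Suc m\<close> could break the new bound. Parity excludes it in the first case. In the
  second, being smallest, it would force all piles to equal \<open>Suc m\<close>, which is too many
  stones.\<close>

lemma exact_position_move:
  assumes "length x = k + 1" "exact_position k (Suc m) x" "M_move k x y"
  shows "exact_position k m y"
proof -
  obtain i where i: "i < k + 1" "M_kept x i" "length y = k + 1" and x: "x = raise_all_but i y"
    using M_move_obtain[OF assms(3,1)] .
  have xn: "x ! j = (if j = i then y ! j else Suc (y ! j))" if "j < k + 1" for j
    using that i x nth_raise_all_but by simp
  have s: "sum_list y = k * m"
    using assms(2) sum_list_raise_all_but[OF i(3,1)] x by (simp add: exact_position_def)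
  have le: "x ! j \<le> Suc m" if "j < k + 1" for j
    using assms(1,2) that by (simp add: exact_position_def)
  show ?thesis
  proof (cases "even m")
    case True
    then obtain a where a: "a < k + 1" "\<And>j. j < k + 1 \<Longrightarrow> even (x ! j) \<longleftrightarrow> j = a"
      using assms(1,2) unfolding exact_position_def by auto
    have "i = a" using i(1,2) a assms(1) unfolding M_kept_def by metis
    have "even (y ! j)" if "j < k + 1" for j
      using xn[OF that] a(2)[OF that] \<open>i = a\<close> by (auto split: if_splits)
    moreover have "y ! j \<le> m" if "j < k + 1" for j
    proof (cases "j = i")
      case True
      then have "even (x ! j)" using a \<open>i = a\<close> by simp
      then have "x ! j \<noteq> Suc m" using \<open>even m\<close> by (metis even_Suc)
      then show ?thesis using le[OF that] xn[OF that] True by simp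
    qed (use le[OF that] xn[OF that] in simp)
    ultimately show ?thesis using s True i(3) by (simp add: exact_position_def)
  next
    case False
    have ev: "even (x ! j)" if "j < k + 1" for j
      using assms(1,2) that False by (simp add: exact_position_def)
    have least: "x ! i \<le> x ! j" if "j < k + 1" for j
      using i(2) ev that assms(1) unfolding M_kept_def by (metis zero_less_Suc Suc_eq_plus1)
    have "x ! i \<noteq> Suc m"
    proof
      assume *: "x ! i = Suc m"
      have "x = replicate (k + 1) (Suc m)"
        using assms(1) le least * by (intro nth_equalityI) (auto intro!: le_antisym simp del: replicate.simps)
      then have "sum_list x = (k + 1) * Suc m" using sum_list_replicate[of "k + 1" "Suc m"] by simp
      then show False using assms(2) by (simp add: exact_position_def)
    qed
    then have "y ! j \<le> m" if "j < k + 1" for j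
      using le[OF that] xn[OF that] by (auto split: if_splits)
    moreover have "even (y ! j) \<longleftrightarrow> j = i" if "j < k + 1" for j
      using ev[OF that] xn[OF that] by (auto split: if_splits)
    ultimately show ?thesis using s False i(1,3) by (auto simp: exact_position_def)
  qed
qed

text \<open>All piles are odd, so a largest pile is kept and is the only odd one afterwards.\<close>

lemma surplus_position_move:
  assumes "length x = k + 1" "0 < k" "surplus_position k (Suc m) x" "M_move k x y"
  shows "surplus_successor k m y"
proof -
  obtain i where i: "i < k + 1" "M_kept x i" "length y = k + 1" and x: "x = raise_all_but i y"
    using M_move_obtain[OF assms(4,1)] .
  have xn: "x ! j = (if j = i then y ! j else Suc (y ! j))" if "j < k + 1" for j
    using that i x nth_raise_all_but by simp
  have "sum_list x = k * Suc m + k - 1" using assms(3) by (simp add: surplus_position_def)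
  then have s: "sum_list y = k * m + k - 1"
    using assms(2) sum_list_raise_all_but[OF i(3,1), folded x] unfolding mult_Suc_right by linarith
  have x': "x ! j < Suc m" "odd (x ! j)" if "j < k + 1" for j
    using assms(1,3) that by (simp_all add: surplus_position_def)
  have "odd (y ! j) \<longleftrightarrow> j = i" "y ! j \<le> m + 1" if "j < k + 1" for j
    using xn[OF that] x'[OF that] by (auto split: if_splits)
  moreover have "odd m" using assms(3) by (simp add: surplus_position_def)
  ultimately show ?thesis using s i unfolding surplus_successor_def by auto
qed

text \<open>From two even piles, one is kept and the other becomes the unique odd pile. From a unique odd
  pile, that pile and the kept one become the two even piles. As for exact positions, the new
  bound could fail only at the kept pile, which is excluded by parity or by the total number
  of stones.\<close>

lemma surplus_successor_move:
  assumes "length x = k + 1" "0 < k" "surplus_successor k (Suc m) x" "M_move k x y"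
  shows "surplus_successor k m y"
proof -
  obtain i where i: "i < k + 1" "M_kept x i" "length y = k + 1" and x: "x = raise_all_but i y"
    using M_move_obtain[OF assms(4,1)] .
  have xn: "x ! j = (if j = i then y ! j else Suc (y ! j))" if "j < k + 1" for j
    using that i x nth_raise_all_but by simp
  have "sum_list x = k * Suc m + k - 1" using assms(3) by (simp add: surplus_successor_def)
  then have s: "sum_list y = k * m + k - 1"
    using assms(2) sum_list_raise_all_but[OF i(3,1), folded x] unfolding mult_Suc_right by linarith
  have le: "x ! j \<le> m + 2" if "j < k + 1" for j
    using assms(1,3) that by (simp add: surplus_successor_def)
  have kept: "even (x ! i)" "\<And>l. l < k + 1 \<Longrightarrow> even (x ! l) \<Longrightarrow> x ! i \<le> x ! l"
    if "j < k + 1" "even (x ! j)" for j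
    using i(2) that assms(1) unfolding M_kept_def by metis+
  have y_le: "y ! j \<le> m + 1" if "j < k + 1" "x ! i \<noteq> m + 2" for j
    using xn[OF that(1)] le[OF that(1)] that(2) by (auto split: if_splits)
  show ?thesis
  proof (cases "odd m")
    case True
    then obtain a b where ab: "a < k + 1" "b < k + 1" "a \<noteq> b"
      "\<And>j. j < k + 1 \<Longrightarrow> even (x ! j) \<longleftrightarrow> j = a \<or> j = b"
      using assms(1,3) unfolding surplus_successor_def by (auto split: if_splits)
    have evi: "even (x ! i)" using kept(1)[OF ab(1)] ab by blast
    then have "x ! i \<noteq> m + 2" using True by auto
    moreover obtain c where c: "c < k + 1" "c \<noteq> i"
      "\<And>j. j < k + 1 \<Longrightarrow> even (x ! j) \<longleftrightarrow> j = i \<or> j = c"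
      using ab ab(4)[OF i(1)] evi by (cases "i = a") auto
    have "odd (y ! j) \<longleftrightarrow> j = c" if "j < k + 1" for j
      using xn[OF that] c(3)[OF that] c(2) by (auto split: if_splits)
    ultimately show ?thesis using s True y_le i(3) c(1) unfolding surplus_successor_def by auto
  next
    case False
    then obtain a where a: "a < k + 1" "\<And>j. j < k + 1 \<Longrightarrow> odd (x ! j) \<longleftrightarrow> j = a"
      using assms(1,3) unfolding surplus_successor_def by auto
    obtain c where c: "c < k + 1" "c \<noteq> a"
      using a(1) assms(2) by (cases "a = 0") (auto intro: that[of 0] that[of 1])
    have evi: "even (x ! i)" using kept(1)[OF c(1)] c a by blast
    then have "i \<noteq> a" using a by blast
    \<comment> \<open>Otherwise all \<open>k\<close> even piles equal \<open>m + 2\<close>, since the kept one is smallest.\<close>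
    have "x ! i \<noteq> m + 2"
    proof
      assume *: "x ! i = m + 2"
      have "x = (replicate (k + 1) (m + 2))[a := x ! a]"
      proof (rule nth_equalityI)
        fix j assume "j < length x"
        then have j: "j < k + 1" using assms(1) by simp
        have "x ! j = m + 2" if "j \<noteq> a"
          using le[OF j] kept(2)[OF i(1) evi j] a(2)[OF j] that * by simp
        then show "x ! j = (replicate (k + 1) (m + 2))[a := x ! a] ! j"
          using j by (cases "j = a") (simp_all del: replicate.simps)
      qed (use assms(1) in \<open>simp del: replicate.simps\<close>)
      moreover have "sum_list ((replicate (k + 1) (m + 2))[a := x ! a]) =
          sum_list (replicate (k + 1) (m + 2)) + x ! a - (m + 2)"
        using a(1) by (simp add: sum_list_update del: replicate.simps)
      ultimately have "sum_list x = sum_list (replicate (k + 1) (m + 2)) + x ! a - (m + 2)" by metis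
      then have "sum_list x \<ge> k * (m + 2)" by (simp add: sum_list_replicate)
      then show False using assms(2,3) by (simp add: surplus_successor_def)
    qed
    moreover have "even (y ! j) \<longleftrightarrow> j = i \<or> j = a" if "j < k + 1" for j
      using xn[OF that] a(2)[OF that] \<open>i \<noteq> a\<close> evi by (auto split: if_splits)
    ultimately show ?thesis
      using s False y_le i(1,3) a(1) \<open>i \<noteq> a\<close> unfolding surplus_successor_def by auto
  qed
qed

lemma M_length_exact_position:
  assumes "length x = k + 1" "0 < k" "exact_position k m x"
  shows "M_length k x = m"
  using assms(1,3)
proof (induction m arbitrary: x)
  case 0
  then have "sum_list x = 0" by (simp only: exact_position_def mult_0_right)
  then have "sum_list x < k" using assms(2) by (rule ord_eq_less_trans)
  then show ?case using M_length_terminal 0 assms(2) terminal_if_sum_list_lt by blast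
next
  case (Suc m)
  have "(k - 1) * Suc m < k * Suc m" using assms(2) by (intro mult_strict_right_mono) auto
  then have "\<not> nim_terminal k x"
    using Suc.prems by (intro not_terminal_if_sum_list_gt) (auto simp: exact_position_def)
  then obtain y where y: "M_move k x y" using M_move_exists Suc.prems(1) by blast
  have "length y = k + 1" using M_move_obtain[OF y Suc.prems(1)] by blast
  then have "M_length k y = m"
    using Suc.IH exact_position_move[OF Suc.prems(1,2) y] by blast
  then show ?case using M_length_step[OF Suc.prems(1) assms(2) y] by simp
qed

text \<open>The estimate behind the bound in \<^const>\<open>surplus_successor\<close>.\<close>

lemma surplus_not_terminal:
  assumes "sum_list x = k * Suc m + k - 1" "\<forall>j<length x. x ! j \<le> Suc m + 1" "0 < k"
  shows "\<not> nim_terminal k x"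
proof -
  obtain l where "k = Suc l" using assms(3) gr0_implies_Suc by blast
  then have "(k - 1) * (Suc m + 1) < sum_list x" using assms(1) by simp
  then show ?thesis using assms(2) by (rule not_terminal_if_sum_list_gt)
qed

lemma M_length_surplus_successor:
  assumes "length x = k + 1" "0 < k" "surplus_successor k m x"
  shows "M_length k x = m"
  using assms(1,3)
proof (induction m arbitrary: x)
  case 0
  then have "sum_list x < k" using assms(2) by (simp add: surplus_successor_def)
  then show ?case using M_length_terminal 0 assms(2) terminal_if_sum_list_lt by blast
next
  case (Suc m)
  have "\<not> nim_terminal k x"
    using Suc.prems assms(2) by (intro surplus_not_terminal[of _ _ m]) (simp_all add: surplus_successor_def)
  then obtain y where y: "M_move k x y" using M_move_exists Suc.prems(1) by blast
  have "length y = k + 1" using M_move_obtain[OF y Suc.prems(1)] by blast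
  then have "M_length k y = m"
    using Suc.IH surplus_successor_move[OF Suc.prems(1) assms(2) Suc.prems(2) y] by blast
  then show ?case using M_length_step[OF Suc.prems(1) assms(2) y] by simp
qed

lemma M_length_surplus_position:
  assumes "length x = k + 1" "0 < k" "surplus_position k m x"
  shows "M_length k x = m"
proof -
  have "x ! 0 < m" using assms(1,3) by (simp add: surplus_position_def)
  then obtain l where m: "m = Suc l" by (cases m) auto
  have "\<not> nim_terminal k x"
    using assms m by (intro surplus_not_terminal[of _ _ l]) (auto simp: surplus_position_def less_Suc_eq_le le_Suc_eq)
  then obtain y where y: "M_move k x y" using M_move_exists assms(1) by blast
  have "length y = k + 1" using M_move_obtain[OF y assms(1)] by blast
  then have "M_length k y = l"
    using M_length_surplus_successor surplus_position_move[OF assms(1,2) _ y] assms(2,3) m by blast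
  then show ?thesis using M_length_step[OF assms(1,2) y] m by simp
qed

definition extremal :: "nat \<Rightarrow> nat \<Rightarrow> nat list \<Rightarrow> bool" where
  "extremal k m x \<longleftrightarrow> length x = k + 1 \<and> (exact_position k m x \<or> surplus_position k m x)"

lemma M_length_extremal: "extremal k m x \<Longrightarrow> 0 < k \<Longrightarrow> M_length k x = m"
  unfolding extremal_def using M_length_exact_position M_length_surplus_position by blast


section \<open>An extremal position below every position\<close>

definition transfer_stone :: "nat \<Rightarrow> nat \<Rightarrow> nat list \<Rightarrow> nat list" where
  "transfer_stone a b y = y[a := y ! a - 1, b := Suc (y ! b)]"

lemma length_transfer_stone [simp]: "length (transfer_stone a b y) = length y"
  by (simp add: transfer_stone_def)

lemma nth_transfer_stone:
  "a \<noteq> b \<Longrightarrow> j < length y \<Longrightarrow>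
    transfer_stone a b y ! j = (if j = a then y ! j - 1 else if j = b then Suc (y ! j) else y ! j)"
  by (auto simp: transfer_stone_def nth_list_update)

lemma sum_list_transfer_stone:
  assumes "a < length y" "b < length y" "a \<noteq> b" "0 < y ! a"
  shows "sum_list (transfer_stone a b y) = sum_list y"
proof -
  have "y ! a \<le> sum_list y" using assms by (simp add: elem_le_sum_list)
  moreover have "sum_list (y[a := y ! a - 1]) = sum_list y + (y ! a - 1) - y ! a"
    using assms by (simp add: sum_list_update)
  moreover have "y ! b \<le> sum_list (y[a := y ! a - 1])"
    using assms elem_le_sum_list[of b "y[a := y ! a - 1]"] by simp
  ultimately show ?thesis
    using assms by (simp add: transfer_stone_def sum_list_update)
qed

text \<open>Here \<open>y\<close> would be exact but for its two odd piles \<open>i\<close> and \<open>j\<close>, where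
  \<open>i\<close> is the pile that the move from \<open>x\<close> kept. If \<open>x\<close> has room above one of the
  two, a stone from the other one makes both even. If there is room for two stones on a third
  pile \<open>l\<close>, both odd piles give it one. Otherwise \<open>y\<close> agrees with \<open>x\<close> at
  \<open>i\<close> and \<open>j\<close>; then the kept pile \<open>x ! i\<close> is odd, so by the M-rule all piles
  of \<open>x\<close> are odd and it is a largest one, and \<open>x\<close> exceeds \<open>y\<close> by exactly one
  on the remaining \<open>k - 1\<close> piles.\<close>

lemma rebalance_two_odd:
  assumes len: "length x = k + 1" "length y = k + 1"
    and le: "\<And>l. l < k + 1 \<Longrightarrow> y ! l \<le> x ! l"
    and s: "sum_list y = k * m" and max: "\<And>l. l < k + 1 \<Longrightarrow> y ! l \<le> m" and m: "even m"
    and ij: "i < k + 1" "j < k + 1" "i \<noteq> j"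
    and odd_iff: "\<And>l. l < k + 1 \<Longrightarrow> odd (y ! l) \<longleftrightarrow> l = i \<or> l = j"
    and kept: "M_kept x i"
  shows "\<exists>z. extremal k m z \<and> (\<forall>l<k+1. z ! l \<le> x ! l)"
proof -
  have odd: "odd (y ! i)" "odd (y ! j)" using odd_iff ij by auto
  then have pos: "0 < y ! i" "0 < y ! j" by (auto intro: odd_pos)
  have lt: "y ! i < m" "y ! j < m" using odd m max[OF ij(1)] max[OF ij(2)] by (auto simp: order_le_less)
  have exact: "\<exists>z. extremal k m z \<and> (\<forall>l<k+1. z ! l \<le> x ! l)"
    if "length z = k + 1" "sum_list z = k * m"
      "\<And>l. l < k + 1 \<Longrightarrow> z ! l \<le> m \<and> even (z ! l) \<and> z ! l \<le> x ! l" for z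
    using that m by (auto simp: extremal_def exact_position_def intro!: exI[of _ z])
  have eq: "y ! i < x ! i \<or> y ! i = x ! i" "y ! j < x ! j \<or> y ! j = x ! j"
    using le[OF ij(1)] le[OF ij(2)] by linarith+
  have gap: "y ! l + 2 \<le> x ! l \<or> x ! l \<le> Suc (y ! l)" for l by linarith
  consider "y ! i < x ! i" | "y ! j < x ! j"
    | l where "l < k + 1" "l \<noteq> i" "l \<noteq> j" "y ! l + 2 \<le> x ! l" "y ! i = x ! i" "y ! j = x ! j"
    | "y ! i = x ! i" "y ! j = x ! j" "\<And>l. l < k + 1 \<Longrightarrow> l \<noteq> i \<Longrightarrow> l \<noteq> j \<Longrightarrow> x ! l \<le> Suc (y ! l)"
    using eq gap by blast
  then show ?thesis
  proof cases
    case 1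
    show ?thesis
    proof (rule exact[of "transfer_stone j i y"])
      fix l assume "l < k + 1"
      then show "transfer_stone j i y ! l \<le> m \<and> even (transfer_stone j i y ! l) \<and>
          transfer_stone j i y ! l \<le> x ! l"
        using ij 1 lt odd pos le[of l] max[of l] odd_iff[of l] len by (auto simp: nth_transfer_stone)
    qed (use ij pos len s in \<open>simp_all add: sum_list_transfer_stone\<close>)
  next
    case 2
    show ?thesis
    proof (rule exact[of "transfer_stone i j y"])
      fix l assume "l < k + 1"
      then show "transfer_stone i j y ! l \<le> m \<and> even (transfer_stone i j y ! l) \<and>
          transfer_stone i j y ! l \<le> x ! l"
        using ij 2 lt odd pos le[of l] max[of l] odd_iff[of l] len by (auto simp: nth_transfer_stone)
    qed (use ij pos len s in \<open>simp_all add: sum_list_transfer_stone\<close>)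
  next
    case (3 l)
    have "odd (x ! i)" using 3 odd by simp
    then have "x ! l \<le> x ! i" using kept 3(1) len(1) unfolding M_kept_def by (metis Suc_eq_plus1)
    \<comment> \<open>This is where the kept pile being a largest one bounds the pile that receives two stones.\<close>
    then have lm: "y ! l + 2 \<le> m" using 3 max[OF ij(1)] by simp
    let ?z = "transfer_stone j l (transfer_stone i l y)"
    show ?thesis
    proof (rule exact[of ?z])
      fix h assume "h < k + 1"
      then show "?z ! h \<le> m \<and> even (?z ! h) \<and> ?z ! h \<le> x ! h"
        using ij 3 lm lt odd pos le[of h] max[of h] odd_iff[of h] len by (auto simp: nth_transfer_stone)
    qed (use ij 3 pos len s in \<open>simp_all add: sum_list_transfer_stone nth_transfer_stone\<close>)
  next
    case 4
    have "odd (x ! i)" using 4 odd by simp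
    then have x: "odd (x ! l)" "x ! l \<le> x ! i" if "l < k + 1" for l
      using kept that len(1) unfolding M_kept_def by (metis Suc_eq_plus1)+
    have "x ! l = Suc (y ! l)" if l: "l < k + 1" "l \<noteq> i" "l \<noteq> j" for l
    proof -
      have "even (y ! l)" using odd_iff l by blast
      then have "x ! l \<noteq> y ! l" using x(1)[OF l(1)] by auto
      then show ?thesis using 4(3)[OF l] le[OF l(1)] by simp
    qed
    then have "raise_all_but i y ! l = x[j := Suc (x ! j)] ! l" if "l < k + 1" for l
      unfolding nth_raise_all_but[OF that[folded len(2)]] nth_list_update[OF ij(2)[folded len(1)]]
      using that 4(1,2) ij(3) by presburger
    then have xy: "raise_all_but i y = x[j := Suc (x ! j)]"
      using len by (intro nth_equalityI) simp_all
    have "sum_list y + k = Suc (sum_list x)"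
    proof -
      have "x ! j \<le> sum_list x" using ij len by (simp add: elem_le_sum_list)
      then have "sum_list (x[j := Suc (x ! j)]) = Suc (sum_list x)"
        using ij len by (simp add: sum_list_update)
      then show ?thesis using sum_list_raise_all_but[OF len(2) ij(1)] xy by simp
    qed
    then have "surplus_position k m x"
      using s m x lt(1) 4(1) len(1) unfolding surplus_position_def by (auto intro: le_less_trans)
    then show ?thesis using len(1) by (auto simp: extremal_def)
  qed
qed

text \<open>If \<open>y\<close> is exact, raising all its piles but the kept one gives the right sum; the
  parities are right too unless \<open>m\<close> is odd and the even pile of \<open>y\<close> is not the kept one,
  which leaves two odd piles to rebalance. If \<open>y\<close> is a surplus position, its \<open>k - 1\<close>
  extra stones together with a single new one already make up the \<open>k\<close> stones required.\<close>

lemma extremal_below_step: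
  assumes "length x = k + 1" "0 < k" "M_move k x x'"
    and "extremal k m y" "\<forall>j<k+1. y ! j \<le> x' ! j"
  shows "\<exists>z. extremal k (Suc m) z \<and> (\<forall>j<k+1. z ! j \<le> x ! j)"
proof -
  obtain i where i: "i < k + 1" "M_kept x i" "length x' = k + 1" and x: "x = raise_all_but i x'"
    using M_move_obtain[OF assms(3,1)] .
  have ly: "length y = k + 1" using assms(4) by (simp add: extremal_def)
  have xn: "x ! j = (if j = i then x' ! j else Suc (x' ! j))" if "j < k + 1" for j
    using that i x nth_raise_all_but by simp
  let ?y = "raise_all_but i y"
  have yn: "?y ! j = (if j = i then y ! j else Suc (y ! j))" if "j < k + 1" for j
    using that ly nth_raise_all_but by simp
  have le: "?y ! j \<le> x ! j" if "j < k + 1" for j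
    using assms(5) that xn[OF that] yn[OF that] by auto
  have sy: "sum_list ?y = sum_list y + k" using sum_list_raise_all_but[OF ly i(1)] .
  show ?thesis
  proof (cases "exact_position k m y")
    case exact: True
    have sum: "sum_list ?y = k * Suc m" using exact sy by (simp add: exact_position_def)
    have max: "?y ! j \<le> Suc m" if "j < k + 1" for j
      using exact ly that yn[OF that] by (auto simp: exact_position_def le_Suc_eq)
    show ?thesis
    proof (cases "even m")
      case True
      then have "even (?y ! j) \<longleftrightarrow> j = i" if "j < k + 1" for j
        using exact ly that yn[OF that] by (auto simp: exact_position_def)
      then have "extremal k (Suc m) ?y"
        using True ly sum max i(1) by (auto simp: extremal_def exact_position_def)
      then show ?thesis using le by blast
    next
      case False
      then obtain j where j: "j < k + 1" "\<And>l. l < k + 1 \<Longrightarrow> even (y ! l) \<longleftrightarrow> l = j"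
        using exact ly unfolding exact_position_def by auto
      show ?thesis
      proof (cases "j = i")
        case True
        have "even (?y ! l)" if "l < k + 1" for l
          using yn[OF that] j(2)[OF that] True by auto
        then have "extremal k (Suc m) ?y"
          using False ly sum max by (auto simp: extremal_def exact_position_def)
        then show ?thesis using le by blast
      next
        case neq: False
        have odd_iff: "odd (?y ! l) \<longleftrightarrow> l = i \<or> l = j" if "l < k + 1" for l
          using yn[OF that] j(2)[OF that] neq by auto
        show ?thesis
          by (rule rebalance_two_odd[where y = ?y and i = i and j = j])
            (use assms(1) ly le sum max False i j neq odd_iff in auto)
      qed
    qed
  next
    case False
    then have surplus: "sum_list y = k * m + k - 1" "even m"
      "\<And>j. j < k + 1 \<Longrightarrow> y ! j < m" "\<And>j. j < k + 1 \<Longrightarrow> odd (y ! j)"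
      using assms(4) ly by (auto simp: extremal_def surplus_position_def)
    \<comment> \<open>Any pile except the kept one has grown by one stone when the move is undone, so it has room.\<close>
    obtain j where j: "j < k + 1" "j \<noteq> i"
      using i(1) assms(2) by (cases "i = 0") (auto intro: that[of 0] that[of 1])
    let ?z = "y[j := Suc (y ! j)]"
    have zn: "?z ! l = (if l = j then Suc (y ! j) else y ! l)" if "l < k + 1" for l
      using that ly by (simp add: nth_list_update)
    have "y ! j \<le> sum_list y" using j ly by (simp add: elem_le_sum_list)
    then have "sum_list ?z = k * Suc m"
      using surplus(1) j ly assms(2) by (simp add: sum_list_update)
    moreover have "?z ! l \<le> Suc m" "even (?z ! l) \<longleftrightarrow> l = j" if "l < k + 1" for l
      using zn[OF that] surplus(3,4)[OF that] by auto
    ultimately have "extremal k (Suc m) ?z"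
      using surplus(2) ly j(1) by (auto simp: extremal_def exact_position_def)
    moreover have "?z ! l \<le> x ! l" if "l < k + 1" for l
      using zn[OF that] xn[OF that] assms(5) that j(2) by (auto simp: le_SucI)
    ultimately show ?thesis by blast
  qed
qed

lemma extremal_below:
  assumes "length x = k + 1" "0 < k" "M_length k x = m"
  shows "\<exists>y. extremal k m y \<and> (\<forall>j<k+1. y ! j \<le> x ! j)"
  using assms(1,3)
proof (induction m arbitrary: x)
  case 0
  have "extremal k 0 (replicate (k + 1) 0)"
    by (simp add: extremal_def exact_position_def sum_list_replicate del: replicate.simps)
  then show ?case by (intro exI[of _ "replicate (k + 1) 0"]) (simp del: replicate.simps)
next
  case (Suc m)
  then have "\<not> nim_terminal k x" using M_length_terminal[OF Suc.prems(1) assms(2)] by auto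
  then obtain z where z: "M_move k x z" using M_move_exists Suc.prems(1) by blast
  have "length z = k + 1" using M_move_obtain[OF z Suc.prems(1)] by blast
  moreover have "M_length k z = m" using M_length_step[OF Suc.prems(1) assms(2) z] Suc.prems(2) by simp
  ultimately show ?case using Suc.IH extremal_below_step[OF Suc.prems(1) assms(2) z] by blast
qed


section \<open>Critical positions\<close>

text \<open>Needed because domination determines a position only up to the order of its piles.\<close>

lemma extremal_mset:
  assumes "mset x = mset y" "extremal k m x"
  shows "extremal k m y"
proof -
  have all: "(\<forall>j<length x. P (x ! j)) \<longleftrightarrow> (\<forall>j<length y. P (y ! j))" for P
    unfolding all_set_conv_all_nth[symmetric] using mset_eq_setD[OF assms(1)] by simp
  have singleton: "(\<exists>!j. Q j) \<longleftrightarrow> (\<exists>a. {j. Q j} = {a})" for Q :: "nat \<Rightarrow> bool"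
    by (auto simp: set_eq_iff)
  have ex1: "(\<exists>!j. j < length z \<and> P (z ! j)) \<longleftrightarrow> size (filter_mset P (mset z)) = 1"
    for P and z :: "nat list"
    unfolding mset_filter[symmetric] size_mset length_filter_conv_card singleton
    by (simp add: card_1_singleton_iff)
  have "length x = length y" "sum_list x = sum_list y"
    using mset_eq_length[OF assms(1)] arg_cong[OF assms(1), of sum_mset]
    by (simp_all add: sum_mset_sum_list)
  then show ?thesis
    using assms(2)
    unfolding extremal_def exact_position_def surplus_position_def ex1 assms(1)
      all[of "\<lambda>v. v \<le> m"] all[of "\<lambda>v. v < m"] all[of even] all[of odd]
    by simp
qed

lemma extremal_antichain:
  assumes "0 < k" "extremal k m x" "extremal k m y"
  shows "\<not> strictly_dominates x y"
proof
  assume sd: "strictly_dominates x y"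
  then have less: "sum_list y < sum_list x" by (rule strictly_dominates_sum_list)
  have sums: "exact_position k m z \<Longrightarrow> sum_list z = k * m"
    "surplus_position k m z \<Longrightarrow> sum_list z = k * m + (k - 1)" for z
    using assms(1) by (simp_all add: exact_position_def surplus_position_def)
  \<comment> \<open>The sums leave only this combination, since positions of the same kind have equal sums.\<close>
  have "surplus_position k m x" "exact_position k m y"
    using assms(2,3) sums[of x] sums[of y] less by (auto simp: extremal_def)
  moreover from this have "sum_list y + length x \<le> sum_list x"
    using sd unfolding strictly_dominates_def exact_position_def surplus_position_def
    by (intro dominates_odd_even_sum_list) (auto simp: all_set_conv_all_nth)
  ultimately show False
    using assms(2) by (simp add: extremal_def exact_position_def surplus_position_def)
qed

lemma critical_iff_extremal:
  assumes "0 < k" "length x = k + 1"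
  shows "critical k m x \<longleftrightarrow> extremal k m x"
proof
  assume crit: "critical k m x"
  then obtain y where y: "extremal k m y" "\<forall>j<k+1. y ! j \<le> x ! j"
    using extremal_below[OF assms(2,1)] by (auto simp: critical_def)
  then have "dominates x y" using assms(2) by (intro dominatesI) (auto simp: extremal_def)
  moreover have "\<not> strictly_dominates x y"
    using crit y(1) M_length_extremal[OF y(1) assms(1)]
    by (auto simp: critical_def extremal_def positions_def)
  ultimately have "sort x = sort y" by (simp add: strictly_dominates_def)
  then have "mset y = mset x" by (metis mset_sort)
  then show "extremal k m x" using extremal_mset y(1) by blast
next
  assume ext: "extremal k m x"
  have "\<not> strictly_dominates x y" if y: "length y = k + 1" "M_length k y = m" for y
  proof
    assume sd: "strictly_dominates x y"
    obtain z where z: "extremal k m z" "\<forall>j<k+1. z ! j \<le> y ! j"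
      using extremal_below[OF y(1) assms(1) y(2)] by blast
    then have "dominates y z" using y(1) by (intro dominatesI) (auto simp: extremal_def)
    then have "dominates x z" "sum_list z < sum_list x"
      using sd dominates_trans le_less_trans[OF dominates_sum_list strictly_dominates_sum_list[OF sd]]
      unfolding strictly_dominates_def by blast+
    then have "strictly_dominates x z"
      using sum_list_sort[of x] sum_list_sort[of z] by (auto simp: strictly_dominates_def)
    then show False using extremal_antichain[OF assms(1) ext z(1)] by blast
  qed
  then show "critical k m x"
    using assms(2) M_length_extremal[OF ext assms(1)] by (auto simp: critical_def positions_def)
qed

theorem theorem1:
  fixes k n m :: nat and x :: "nat list"
  assumes "1 \<le> k" and "n = k + 1" and "x \<in> positions n"
  shows "critical k m x \<longleftrightarrow>
    (sum_list x = k * m \<and> Max (set x) \<le> m \<and>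
     (even m \<longrightarrow> (\<forall>i<n. even (x ! i))) \<and>
     (odd m \<longrightarrow> (\<exists>!i. i < n \<and> even (x ! i))))
    \<or>
    (sum_list x = k * m + k - 1 \<and> Max (set x) < m \<and> even m \<and>
     (\<forall>i<n. odd (x ! i)))"
proof -
  have len: "length x = n" "length x = k + 1" using assms by (simp_all add: positions_def)
  then have "x \<noteq> []" by auto
  then have max: "Max (set x) \<le> m \<longleftrightarrow> (\<forall>j<length x. x ! j \<le> m)"
    "Max (set x) < m \<longleftrightarrow> (\<forall>j<length x. x ! j < m)"
    by (simp_all add: all_set_conv_all_nth)
  have "critical k m x \<longleftrightarrow> extremal k m x" using critical_iff_extremal assms(1) len(2) by simp
  then show ?thesis
    using len unfolding extremal_def exact_position_def surplus_position_def max by auto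
qed

end
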